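(* Let $\gamma>0$, $\Omega=[0,1]$, and let $(\chi,v)$ be a global (sticky) Lagrangian solution, in the sense given in the context, of the one-dimensional damped pressureless Euler system $$\partial_t\chi_t(\eta)=v_t(\eta),\qquad \partial_tv_t(\eta)=-(\partial_xV)(\chi_t(\eta))-\int_\Omega(\partial_xW)(\chi_t(\eta)-\chi_t(\bar\eta))\,d\bar\eta-\gamma v_t(\eta)$$ with potentials $V(x)=|x|^2/2$ and $W(x)=|x|$. Suppose the initial data satisfies $\|\chi_0\|_{L^2(\Omega)}+\|v_0\|_{L^2(\Omega)}<\infty$. Then $$\lim_{t\to\infty}\Big(\|\chi_t\|_{L^2(\Omega)}+\|v_t\|_{L^2(\Omega)}\Big)=0 .$$ In particular, $$\lim_{t\to\infty}W_2(\mu_t,\mu_\infty)=0,$$ where $\mu_t=\chi_t\#(\mathbf{1}_\Omega\,d\eta)$ and $\mu_\infty=\delta_0$.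
   Context: $W_2$ is the 2-Wasserstein distance on probability measures on $\mathbb{R}$ with finite second moment; $\chi\#m$ denotes push-forward. Let $\mathcal{K}=\{\chi\in L^2(\Omega):\chi\text{ is nondecreasing}\}$ (represented by right-continuous functions), a closed convex cone in $L^2(\Omega)$. For $\chi\in\mathcal{K}$ let $\Omega_\chi=\{\eta\in\Omega:\chi\text{ is constant in an open neighborhood of }\eta\}$ and let $H_\chi=\{\zeta\in L^2(\Omega):\zeta\text{ is constant on each interval }(a,b)\subset\Omega_\chi\}$, a closed subspace. The projection $\mathsf{P}_\chi:L^2(\Omega)\to H_\chi$ is given by $\mathsf{P}_\chi(\zeta)=\zeta$ a.e. in $\Omega\setminus\Omega_\chi$ and $\mathsf{P}_\chi(\zeta)=\frac{1}{b-a}\int_a^b\zeta(\eta)\,d\eta$ in any maximal interval $(a,b)\subset\Omega_\chi$. Write $\mathsf{P}_t=\mathsf{P}_{\chi_t}$. A global (sticky) Lagrangian solution of the system with $V(x)=|x|^2/2$, $W(x)=|x|$ is a pair $(\chi,v)$ with $\chi\in\mathrm{Lip}_{\mathrm{loc}}(\mathbb{R}^+,\mathcal{K})$, $v\in C^1(\mathbb{R}^+,L^2(\Omega))$ and initial data $(\chi_0,v_0)\in\mathcal{K}\times L^2(\Omega)$, solving $$\partial_t\chi_t(\eta)=\mathsf{P}_t(v_t)(\eta),\qquad \partial_tv_t(\eta)=-\mathsf{P}_t(F[\chi_t])(\eta)-\gamma v_t(\eta),$$ where $F[\chi_t](\eta)=\chi_t(\eta)+2\eta-1$. *)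

theory Defs
  imports "HOL-Probability.Probability"
begin

section \<open>The Hilbert space \<open>L\<^sup>2(\<Omega>)\<close>, \<open>\<Omega> = [0,1]\<close>\<close>

abbreviation Leb_Omega :: "real measure"
  where "Leb_Omega \<equiv> lebesgue_on {0..1}"

definition square_integrable :: "(real \<Rightarrow> real) \<Rightarrow> bool"
  where "square_integrable f \<longleftrightarrow>
    f \<in> borel_measurable Leb_Omega \<and> integrable Leb_Omega (\<lambda>\<eta>. (f \<eta>)\<^sup>2)"

definition L2_eq :: "(real \<Rightarrow> real) \<Rightarrow> (real \<Rightarrow> real) \<Rightarrow> bool"
  where "L2_eq f g \<longleftrightarrow>
    square_integrable f \<and> square_integrable g \<and> (AE \<eta> in Leb_Omega. f \<eta> = g \<eta>)"

lemma square_integrable_zero: "square_integrable (\<lambda>_. 0)"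
  by (simp add: square_integrable_def)

lemma square_integrable_mult:
  assumes "square_integrable f" "square_integrable g"
  shows "integrable Leb_Omega (\<lambda>\<eta>. f \<eta> * g \<eta>)"
proof (rule Bochner_Integration.integrable_bound)
  show "integrable Leb_Omega (\<lambda>\<eta>. (f \<eta>)\<^sup>2 + (g \<eta>)\<^sup>2)"
    using assms by (simp add: square_integrable_def)
  show "(\<lambda>\<eta>. f \<eta> * g \<eta>) \<in> borel_measurable Leb_Omega"
    using assms by (auto simp: square_integrable_def intro!: borel_measurable_times)
  have "\<bar>a * b\<bar> \<le> a\<^sup>2 + b\<^sup>2" for a b :: real
    using zero_le_power2[of "a + b"] zero_le_power2[of "a - b"]
      zero_le_power2[of a] zero_le_power2[of b]
    unfolding power2_sum power2_diff abs_le_iff by linarith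
  then show "AE \<eta> in Leb_Omega. norm (f \<eta> * g \<eta>) \<le> norm ((f \<eta>)\<^sup>2 + (g \<eta>)\<^sup>2)"
    by simp
qed

lemma square_integrable_add:
  assumes "square_integrable f" "square_integrable g"
  shows "square_integrable (\<lambda>\<eta>. f \<eta> + g \<eta>)"
  using assms square_integrable_mult[OF assms]
  by (auto simp: square_integrable_def power2_sum mult.assoc)

lemma square_integrable_scale:
  assumes "square_integrable f"
  shows "square_integrable (\<lambda>\<eta>. r * f \<eta>)"
  using assms by (auto simp: square_integrable_def power_mult_distrib)

quotient_type L2 = "real \<Rightarrow> real" / partial: L2_eq
proof (rule part_equivpI)
  show "\<exists>f. L2_eq f f"
    using square_integrable_zero by (auto simp: L2_eq_def)
  show "symp L2_eq"
    by (auto simp: symp_def L2_eq_def)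
  show "transp L2_eq"
    unfolding transp_def L2_eq_def by (auto elim: AE_mp)
qed

instantiation L2 :: real_inner
begin

lift_definition zero_L2 :: L2 is "\<lambda>_. 0"
  by (simp add: L2_eq_def square_integrable_zero)

lift_definition plus_L2 :: "L2 \<Rightarrow> L2 \<Rightarrow> L2" is "\<lambda>f g \<eta>. f \<eta> + g \<eta>"
  unfolding L2_eq_def by (auto intro: square_integrable_add)

lift_definition scaleR_L2 :: "real \<Rightarrow> L2 \<Rightarrow> L2" is "\<lambda>r f \<eta>. r * f \<eta>"
  unfolding L2_eq_def by (auto intro: square_integrable_scale)

lift_definition inner_L2 :: "L2 \<Rightarrow> L2 \<Rightarrow> real" is "\<lambda>f g. LINT \<eta>|Leb_Omega. f \<eta> * g \<eta>"
  unfolding L2_eq_def square_integrable_def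
  by (rule integral_cong_AE) (auto intro!: borel_measurable_times)

definition uminus_L2 :: "L2 \<Rightarrow> L2" where "uminus_L2 f = (-1) *\<^sub>R f"
definition minus_L2 :: "L2 \<Rightarrow> L2 \<Rightarrow> L2" where "minus_L2 f g = f + - g"
definition norm_L2 :: "L2 \<Rightarrow> real" where "norm_L2 f = sqrt (inner f f)"
definition sgn_L2 :: "L2 \<Rightarrow> L2" where "sgn_L2 f = inverse (norm f) *\<^sub>R f"
definition dist_L2 :: "L2 \<Rightarrow> L2 \<Rightarrow> real" where "dist_L2 f g = norm (f - g)"
definition uniformity_L2 :: "(L2 \<times> L2) filter"
  where "uniformity_L2 = (INF e\<in>{0<..}. principal {(f, g). dist f g < e})"
definition open_L2 :: "L2 set \<Rightarrow> bool"
  where "open_L2 U \<longleftrightarrow> (\<forall>f\<in>U. eventually (\<lambda>(f', g). f' = f \<longrightarrow> g \<in> U) uniformity)"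

instance
proof
  fix f g h :: L2 and r s :: real
  show "f + g + h = f + (g + h)"
    by transfer (auto simp: L2_eq_def add.assoc intro!: square_integrable_add)
  show "f + g = g + f"
    by transfer (auto simp: L2_eq_def add.commute intro!: square_integrable_add)
  show "0 + f = f"
    by transfer (auto simp: L2_eq_def)
  show "- f + f = 0"
    unfolding uminus_L2_def
    by transfer
      (auto simp: L2_eq_def square_integrable_zero)
  show "f - g = f + - g"
    by (fact minus_L2_def)
  show "r *\<^sub>R (f + g) = r *\<^sub>R f + r *\<^sub>R g"
    by transfer
      (auto simp: L2_eq_def distrib_left intro!: square_integrable_add square_integrable_scale)
  show "(r + s) *\<^sub>R f = r *\<^sub>R f + s *\<^sub>R f"
    by transfer
      (auto simp: L2_eq_def distrib_right intro!: square_integrable_add square_integrable_scale)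
  show "r *\<^sub>R s *\<^sub>R f = (r * s) *\<^sub>R f"
    by transfer (auto simp: L2_eq_def mult.assoc intro!: square_integrable_scale)
  show "1 *\<^sub>R f = f"
    by transfer (auto simp: L2_eq_def)
  show "sgn f = inverse (norm f) *\<^sub>R f"
    by (fact sgn_L2_def)
  show "dist f g = norm (f - g)"
    by (fact dist_L2_def)
  show "uniformity = (INF e\<in>{0<..}. principal {(f, g :: L2). dist f g < e})"
    by (fact uniformity_L2_def)
  show "open U \<longleftrightarrow> (\<forall>f\<in>U. eventually (\<lambda>(f', g). f' = f \<longrightarrow> g \<in> U) uniformity)" for U :: "L2 set"
    by (fact open_L2_def)
  show "inner f g = inner g f"
    by transfer (simp add: mult.commute)
  show "inner (f + g) h = inner f h + inner g h"
    by transfer (simp add: L2_eq_def distrib_right square_integrable_mult)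
  show "inner (r *\<^sub>R f) g = r * inner f g"
    by transfer (simp add: mult.assoc)
  show "0 \<le> inner f f"
    by transfer simp
  show "inner f f = 0 \<longleftrightarrow> f = 0"
  proof transfer
    fix f assume "L2_eq f f"
    then have f: "square_integrable f" by (simp add: L2_eq_def)
    have "(LINT \<eta>|Leb_Omega. f \<eta> * f \<eta>) = 0 \<longleftrightarrow> (AE \<eta> in Leb_Omega. f \<eta> * f \<eta> = 0)"
      by (rule integral_nonneg_eq_0_iff_AE) (auto intro: square_integrable_mult f)
    then show "(LINT \<eta>|Leb_Omega. f \<eta> * f \<eta>) = 0 \<longleftrightarrow> L2_eq f (\<lambda>_. 0)"
      using f by (simp add: L2_eq_def square_integrable_zero)
  qed
  show "norm f = sqrt (inner f f)"
    by (fact norm_L2_def)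
qed

end

text \<open>
  \<open>rep_L2 \<zeta>\<close> is some representative of the class \<open>\<zeta>\<close>, and \<open>abs_L2 f\<close> is the class of a
  square integrable function \<open>f\<close>.
\<close>

lemma square_integrable_rep: "square_integrable (rep_L2 \<zeta>)"
  using Quotient3_rep_reflp[OF Quotient3_L2, of \<zeta>] by (simp add: L2_eq_def)


section \<open>Nondecreasing functions and the projections \<open>P\<^sub>X\<close>\<close>

text \<open>
  Monotonicity and right continuity are imposed on the open interval only: a nondecreasing
  element of \<open>L\<^sup>2\<close> may be unbounded near both end points, whereas a real function that is monotone
  on the closed interval is bounded.
\<close>

definition rc_monotone_rep :: "(real \<Rightarrow> real) \<Rightarrow> L2 \<Rightarrow> bool"
  where "rc_monotone_rep f X \<longleftrightarrow>
    (AE \<eta> in Leb_Omega. rep_L2 X \<eta> = f \<eta>) \<and>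
    mono_on {0<..<1} f \<and> (\<forall>\<eta>\<in>{0<..<1}. continuous (at_right \<eta>) f)"

definition mono_cone :: "L2 set"
  where "mono_cone = {X. \<exists>f. rc_monotone_rep f X}"

text \<open>For \<open>X \<in> mono_cone\<close>, the values of \<open>rc X\<close> on \<open>(0,1)\<close> do not depend on the choice.\<close>

definition rc :: "L2 \<Rightarrow> real \<Rightarrow> real"
  where "rc X = (SOME f. rc_monotone_rep f X)"

definition const_set :: "L2 \<Rightarrow> real set"
  where "const_set X =
    {\<eta>. \<exists>U. open U \<and> \<eta> \<in> U \<and> U \<subseteq> {0<..<1} \<and> rc X constant_on U}"

text \<open>
  The maximal interval of \<open>const_set X\<close> around \<open>\<eta>\<close> is the connected component of \<open>\<eta>\<close>; its Lebesgue
  measure is its length.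
\<close>

definition sticky_proj_fun :: "L2 \<Rightarrow> (real \<Rightarrow> real) \<Rightarrow> real \<Rightarrow> real"
  where "sticky_proj_fun X f \<eta> =
    (if \<eta> \<in> const_set X
     then let I = connected_component_set (const_set X) \<eta>
          in (LINT s:I|lebesgue. f s) / measure lebesgue I
     else f \<eta>)"

definition sticky_proj :: "L2 \<Rightarrow> L2 \<Rightarrow> L2"
  where "sticky_proj X \<zeta> = abs_L2 (sticky_proj_fun X (rep_L2 \<zeta>))"


section \<open>Sticky Lagrangian solutions\<close>

text \<open>
  The potentials are \<open>V(x) = x\<^sup>2/2\<close> and \<open>W(x) = \<bar>x\<bar>\<close>: the first summand is \<open>V'(X(\<eta>))\<close>, and for
  strictly increasing \<open>X\<close> the second one is \<open>\<integral> W'(X(\<eta>) - X(s)) ds\<close> over \<open>s \<in> \<Omega>\<close>.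
\<close>

definition force :: "L2 \<Rightarrow> L2"
  where "force X = X + abs_L2 (\<lambda>\<eta>. 2 * \<eta> - 1)"

text \<open>
  Curves are defined on \<open>[0,\<infinity>)\<close>; their values at negative times are irrelevant. A locally Lipschitz
  curve in a Hilbert space is differentiable at almost every time only, so the system is required
  at almost every time. The initial data are \<open>X 0\<close> and \<open>v 0\<close>; their \<open>L\<^sup>2\<close> norms are finite by typing.
\<close>

definition sticky_Lagrangian_solution :: "real \<Rightarrow> (real \<Rightarrow> L2) \<Rightarrow> (real \<Rightarrow> L2) \<Rightarrow> bool"
  where "sticky_Lagrangian_solution \<gamma> X v \<longleftrightarrow>
    (\<forall>t\<ge>0. X t \<in> mono_cone) \<and>
    (\<forall>T\<ge>0. \<exists>L. L-lipschitz_on {0..T} X) \<and>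
    (\<exists>v'. (\<forall>t\<ge>0. (v has_vector_derivative v' t) (at t within {0..})) \<and> continuous_on {0..} v') \<and>
    (AE t in lborel. t > 0 \<longrightarrow>
       (X has_vector_derivative sticky_proj (X t) (v t)) (at t) \<and>
       (v has_vector_derivative - sticky_proj (X t) (force (X t)) - \<gamma> *\<^sub>R v t) (at t))"


section \<open>Push-forward and the 2-Wasserstein distance\<close>

definition push_forward :: "L2 \<Rightarrow> real measure"
  where "push_forward X = distr Leb_Omega borel (rep_L2 X)"

definition P2 :: "real measure set"
  where "P2 = {\<mu>. prob_space \<mu> \<and> sets \<mu> = sets borel \<and> (\<integral>\<^sup>+ x. ennreal (x\<^sup>2) \<partial>\<mu>) < \<infinity>}"

definition couplings :: "real measure \<Rightarrow> real measure \<Rightarrow> (real \<times> real) measure set"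
  where "couplings \<mu> \<nu> =
    {\<pi>. sets \<pi> = sets (borel \<Otimes>\<^sub>M borel) \<and> distr \<pi> borel fst = \<mu> \<and> distr \<pi> borel snd = \<nu>}"

definition W2_cost :: "real measure \<Rightarrow> real measure \<Rightarrow> ennreal"
  where "W2_cost \<mu> \<nu> = (INF \<pi>\<in>couplings \<mu> \<nu>. \<integral>\<^sup>+ (x, y). ennreal ((x - y)\<^sup>2) \<partial>\<pi>)"

text \<open>Meaningful on \<open>P2\<close>, where the infimum is finite.\<close>

definition W2 :: "real measure \<Rightarrow> real measure \<Rightarrow> real"
  where "W2 \<mu> \<nu> = sqrt (enn2real (W2_cost \<mu> \<nu>))"

lemma push_forward_in_P2: "push_forward X \<in> P2"
proof -
  have m: "rep_L2 X \<in> borel_measurable Leb_Omega"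
    and i: "integrable Leb_Omega (\<lambda>\<eta>. (rep_L2 X \<eta>)\<^sup>2)"
    using square_integrable_rep[of X] by (auto simp: square_integrable_def)
  interpret prob_space Leb_Omega
    by (rule prob_spaceI) (simp add: emeasure_restrict_space)
  have "prob_space (push_forward X)"
    unfolding push_forward_def by (rule prob_space_distr) (rule m)
  moreover have "(\<integral>\<^sup>+ x. ennreal (x\<^sup>2) \<partial>push_forward X) < \<infinity>"
    unfolding push_forward_def using i m
    by (simp add: nn_integral_distr integrable_iff_bounded)
  ultimately show ?thesis by (simp add: P2_def push_forward_def)
qed

lemma return_in_P2: "return borel a \<in> P2"
  by (simp add: P2_def prob_space_return nn_integral_return)

lemma W2_cost_finite:
  assumes "\<mu> \<in> P2" "\<nu> \<in> P2"
  shows "W2_cost \<mu> \<nu> < \<infinity>"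
proof -
  interpret M: prob_space \<mu> using assms by (simp add: P2_def)
  interpret N: prob_space \<nu> using assms by (simp add: P2_def)
  interpret MN: pair_prob_space \<mu> \<nu> ..
  have s [simp, measurable_cong]: "sets \<mu> = sets borel" "sets \<nu> = sets borel"
    using assms by (auto simp: P2_def)
  have c: "\<mu> \<Otimes>\<^sub>M \<nu> \<in> couplings \<mu> \<nu>"
  proof -
    have "distr (\<mu> \<Otimes>\<^sub>M \<nu>) borel fst = distr (\<mu> \<Otimes>\<^sub>M \<nu>) \<mu> fst"
      "distr (\<mu> \<Otimes>\<^sub>M \<nu>) borel snd = distr (\<mu> \<Otimes>\<^sub>M \<nu>) \<nu> snd"
      by (auto intro!: distr_cong)
    moreover have "distr (\<mu> \<Otimes>\<^sub>M \<nu>) \<mu> fst = \<mu>"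
      using N.distr_pair_fst[of \<mu>] by simp
    moreover have "distr (\<mu> \<Otimes>\<^sub>M \<nu>) \<nu> snd = \<nu>"
    proof (rule measure_eqI)
      fix A assume A: "A \<in> sets (distr (\<mu> \<Otimes>\<^sub>M \<nu>) \<nu> snd)"
      then have A': "A \<in> sets \<nu>" by simp
      then have "emeasure (distr (\<mu> \<Otimes>\<^sub>M \<nu>) \<nu> snd) A
          = emeasure (\<mu> \<Otimes>\<^sub>M \<nu>) (space \<mu> \<times> A)"
        using sets.sets_into_space[of A \<nu>]
        by (auto simp: emeasure_distr space_pair_measure intro!: arg_cong2[where f=emeasure])
      also have "\<dots> = emeasure \<mu> (space \<mu>) * emeasure \<nu> A"
        by (rule N.emeasure_pair_measure_Times[OF sets.top A'])
      finally show "emeasure (distr (\<mu> \<Otimes>\<^sub>M \<nu>) \<nu> snd) A = emeasure \<nu> A"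
        unfolding M.emeasure_space_1 mult_1 .
    qed simp
    ultimately show ?thesis
      by (simp add: couplings_def cong: sets_pair_measure_cong)
  qed
  have "(x - y)\<^sup>2 \<le> 2 * x\<^sup>2 + 2 * y\<^sup>2" for x y :: real
    using zero_le_power2[of "x + y"] by (simp add: power2_sum power2_diff)
  then have "(\<integral>\<^sup>+ (x, y). ennreal ((x - y)\<^sup>2) \<partial>(\<mu> \<Otimes>\<^sub>M \<nu>))
      \<le> (\<integral>\<^sup>+ (x, y). 2 * ennreal (x\<^sup>2) + 2 * ennreal (y\<^sup>2) \<partial>(\<mu> \<Otimes>\<^sub>M \<nu>))"
    by (intro nn_integral_mono)
      (auto simp flip: ennreal_plus ennreal_mult' ennreal_numeral intro!: ennreal_leI)
  also have "\<dots> = (\<integral>\<^sup>+ x. \<integral>\<^sup>+ y. 2 * ennreal (x\<^sup>2) + 2 * ennreal (y\<^sup>2) \<partial>\<nu> \<partial>\<mu>)"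
    by (subst N.nn_integral_fst[symmetric]) (simp_all add: case_prod_beta)
  also have "\<dots> = 2 * (\<integral>\<^sup>+ x. ennreal (x\<^sup>2) \<partial>\<mu>) + 2 * (\<integral>\<^sup>+ y. ennreal (y\<^sup>2) \<partial>\<nu>)"
    by (simp add: nn_integral_add nn_integral_cmult M.emeasure_space_1 N.emeasure_space_1)
  also have "\<dots> < \<infinity>"
    using assms by (auto simp: P2_def ennreal_mult_less_top)
  finally show ?thesis
    unfolding W2_cost_def using c by (meson INF_lower le_less_trans)
qed

end

theory Submission
  imports Defs "HOL-Real_Asymp.Real_Asymp"
begin

text \<open>
  Write \<open>l(\<eta>) = 2\<eta> - 1\<close>. The projection \<open>P\<^sub>X\<close> is self-adjoint, non-expansive and fixes \<open>X\<close>, and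
  \<open>\<langle>X, l\<rangle> \<ge> 0\<close> because \<open>X\<close> is nondecreasing. Hence the energy
  \<open>E = \<parallel>X\<parallel>\<^sup>2/2 + \<langle>X, l\<rangle> + \<parallel>v\<parallel>\<^sup>2/2\<close> satisfies \<open>E' = - \<gamma> \<parallel>v\<parallel>\<^sup>2\<close>, and
  \<open>\<langle>X, v\<rangle>' \<le> \<parallel>v\<parallel>\<^sup>2 - \<parallel>X\<parallel>\<^sup>2 - \<langle>X, l\<rangle> - \<gamma> \<langle>X, v\<rangle>\<close>. For small \<open>\<epsilon> > 0\<close> the modified energy
  \<open>G = E + \<epsilon> \<langle>X, v\<rangle>\<close> is comparable to \<open>E\<close> and satisfies \<open>G' \<le> - (\<epsilon>/2) G\<close> at almost every time,
  so \<open>X\<close> and \<open>v\<close> decay exponentially. The distance \<open>W\<^sub>2(X#d\<eta>, \<delta>\<^sub>0)\<close> is at most \<open>\<parallel>X\<parallel>\<close>.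
\<close>

section \<open>Differential inequalities at almost every time\<close>

text \<open>
  After subtracting a small slope, the image of the exceptional null set is still null, so some value
  strictly between \<open>g a\<close> and \<open>g b\<close> is attained only at points of differentiability; the last such
  point contradicts \<open>g' < 0\<close>.
\<close>

lemma lipschitz_AE_deriv_nonpos_imp_le:
  fixes f :: "real \<Rightarrow> real"
  assumes ab: "a \<le> b" and lip: "L-lipschitz_on {a..b} f"
    and deriv: "AE t in lborel. t \<in> {a<..<b} \<longrightarrow>
      (\<exists>D. (f has_real_derivative D) (at t) \<and> D \<le> 0)"
  shows "f b \<le> f a"
proof (rule ccontr)
  assume "\<not> f b \<le> f a"
  then have ab': "a < b" and fab: "f a < f b" using ab by (auto simp: not_le order_less_le)
  \<comment> \<open>Half the mean slope of \<open>f\<close>: half of the rise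
    \<open>f b - f a\<close> survives in \<open>g\<close>, yet \<open>g\<close> has derivative at
    most \<open>- \<delta>\<close> wherever \<open>f\<close> has a nonpositive one.\<close>
  define \<delta> where "\<delta> = (f b - f a) / (2 * (b - a))"
  define g where "g t = f t - \<delta> * (t - a)" for t
  have \<delta>: "\<delta> > 0" using ab' fab by (simp add: \<delta>_def)
  have "\<delta> * (b - a) = (f b - f a) / 2" using ab' unfolding \<delta>_def by (simp add: divide_eq_eq)
  then have gab: "g a < g b" using fab by (simp add: g_def)
  have cont: "continuous_on {a..b} g"
    unfolding g_def by (intro continuous_intros lipschitz_on_continuous_on[OF lip])
  have glip: "\<bar>g y - g x\<bar> \<le> (L + \<delta>) * \<bar>y - x\<bar>" if "x \<in> {a..b}" "y \<in> {a..b}" for x y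
  proof -
    have "\<bar>f y - f x\<bar> \<le> L * \<bar>y - x\<bar>"
      using lipschitz_onD[OF lip that(2,1)] by (simp add: dist_real_def)
    moreover have "g y - g x = (f y - f x) - \<delta> * (y - x)" by (simp add: g_def algebra_simps)
    moreover have "\<bar>(f y - f x) - \<delta> * (y - x)\<bar> \<le> \<bar>f y - f x\<bar> + \<delta> * \<bar>y - x\<bar>"
      using abs_triangle_ineq4[of "f y - f x" "\<delta> * (y - x)"] \<delta> by (simp add: abs_mult)
    ultimately show ?thesis by (simp add: algebra_simps)
  qed
  \<comment> \<open>With \<open>a\<close> included, a level avoided by the image of \<open>N\<close>
    is not attained at \<open>a\<close>, so every point below \<open>b\<close> where it is attained
    is an interior point of differentiability.\<close>
  define N where "N = {t \<in> {a<..<b}. \<not> (\<exists>D. (f has_real_derivative D) (at t) \<and> D \<le> 0)} \<union> {a}"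
  have "AE t in lebesgue. t \<in> {a<..<b} \<longrightarrow> (\<exists>D. (f has_real_derivative D) (at t) \<and> D \<le> 0)"
    by (rule AE_completion) (rule deriv)
  then obtain M where M:
    "{t \<in> space lebesgue. \<not> (t \<in> {a<..<b} \<longrightarrow> (\<exists>D. (f has_real_derivative D) (at t) \<and> D \<le> 0))} \<subseteq> M"
    "emeasure lebesgue M = 0" "M \<in> sets lebesgue"
    by (rule AE_E)
  then have "negligible M" by (simp add: negligible_iff_null_sets null_sets_def)
  then have "negligible (insert a M)" by simp
  then have "negligible N"
    by (rule negligible_subset) (use M(1) in \<open>auto simp: N_def\<close>)
  then have "negligible (g ` N)"
  proof (rule negligible_locally_Lipschitz_image[rotated])
    fix x assume "x \<in> N"
    moreover have "N \<subseteq> {a..b}" using ab by (auto simp: N_def)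
    ultimately show "\<exists>T B. open T \<and> x \<in> T \<and> (\<forall>y\<in>N \<inter> T. norm (g y - g x) \<le> B * norm (y - x))"
      using glip by (intro exI[of _ UNIV] exI[of _ "L + \<delta>"]) (auto simp: subset_iff)
  qed simp
  then have "\<not> {g a<..<g b} \<subseteq> g ` N"
    using gab open_not_negligible[of "{g a<..<g b}"] negligible_subset by auto
  then obtain y where y: "g a < y" "y < g b" "y \<notin> g ` N"
    unfolding subset_iff greaterThanLessThan_iff by blast
  define S where "S = {t \<in> {a..b}. g t \<le> y}"
  define s where "s = Sup S"
  have "closed S"
    unfolding S_def by (intro continuous_on_closed_Collect_le cont continuous_on_const closed_atLeastAtMost)
  moreover have bdd: "bdd_above S" by (auto simp: S_def intro!: bdd_aboveI[of _ b])
  moreover have "a \<in> S" using ab y by (simp add: S_def)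
  ultimately have "s \<in> S" unfolding s_def by (intro closed_contains_Sup) auto
  then have s: "a \<le> s" "s \<le> b" "g s \<le> y" by (auto simp: S_def)
  \<comment> \<open>Since \<open>g s \<le> y < g b\<close>, the level \<open>y\<close> is attained
    at some point from \<open>s\<close> on; that point lies in \<open>S\<close>, so it is
    \<open>s\<close> itself.\<close>
  obtain s' where s': "s \<le> s'" "s' \<le> b" "g s' = y"
    using IVT'[of g s y b] s y continuous_on_subset[OF cont, of "{s..b}"] by auto
  then have "s' \<le> s" using s by (subst s_def, intro cSup_upper bdd) (simp add: S_def)
  with s' have gs: "g s = y" by simp
  then have "s \<notin> N" "s \<noteq> b" using y by auto
  then obtain D where D: "(f has_real_derivative D) (at s)" "D \<le> 0" and sb: "s < b"
    using s by (auto simp: N_def)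
  have "(g has_real_derivative D - \<delta>) (at s)"
    unfolding g_def by (auto intro!: derivative_eq_intros D)
  then obtain d where d: "d > 0" "\<And>h. 0 < h \<Longrightarrow> h < d \<Longrightarrow> g (s + h) < g s"
    using DERIV_neg_dec_right[of g "D - \<delta>" s] D(2) \<delta> by auto
  define h where "h = min (d / 2) (b - s)"
  have h: "0 < h" "h < d" "s + h \<le> b" using d sb by (auto simp: h_def)
  then have "s + h \<in> S" using d(2)[OF h(1,2)] gs s by (auto simp: S_def)
  then have "s + h \<le> s" unfolding s_def by (intro cSup_upper bdd)
  then show False using h by simp
qed

text \<open>Compactness bounds both curves, and the increment of the product splits into one
  increment of each factor. The energies below are quadratic in the curves and inherit their
  Lipschitz regularity from this.\<close>

lemma lipschitz_on_inner:
  fixes f g :: "'a::metric_space \<Rightarrow> 'b::real_inner"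
  assumes "compact S" and "\<exists>L. L-lipschitz_on S f" and "\<exists>L. L-lipschitz_on S g"
  shows "\<exists>L. L-lipschitz_on S (\<lambda>x. f x \<bullet> g x)"
proof -
  obtain L M where L: "L-lipschitz_on S f" and M: "M-lipschitz_on S g" using assms by blast
  have "bounded (f ` S)" "bounded (g ` S)"
    using assms(1) L M by (auto intro!: compact_imp_bounded compact_continuous_image lipschitz_on_continuous_on)
  then obtain B C where B: "B > 0" "\<And>x. x \<in> S \<Longrightarrow> norm (f x) \<le> B"
    and C: "C > 0" "\<And>x. x \<in> S \<Longrightarrow> norm (g x) \<le> C"
    unfolding bounded_pos by auto
  have "(L * C + B * M)-lipschitz_on S (\<lambda>x. f x \<bullet> g x)"
  proof (rule lipschitz_onI)
    show "0 \<le> L * C + B * M" using B C L M by (simp add: lipschitz_on_nonneg)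
    fix x y assume xy: "x \<in> S" "y \<in> S"
    have "\<bar>f x \<bullet> g x - f y \<bullet> g y\<bar> = \<bar>(f x - f y) \<bullet> g x + f y \<bullet> (g x - g y)\<bar>"
      by (simp add: inner_diff_left inner_diff_right)
    also have "\<dots> \<le> norm (f x - f y) * norm (g x) + norm (f y) * norm (g x - g y)"
      by (intro order_trans[OF abs_triangle_ineq] add_mono Cauchy_Schwarz_ineq2)
    also have "\<dots> \<le> (L * dist x y) * C + B * (M * dist x y)"
      using lipschitz_onD[OF L xy] lipschitz_onD[OF M xy] B C xy
      by (intro add_mono mult_mono) (auto simp: lipschitz_on_nonneg[OF L] simp flip: dist_norm)
    finally show "dist (f x \<bullet> g x) (f y \<bullet> g y) \<le> (L * C + B * M) * dist x y"
      by (simp add: dist_real_def algebra_simps)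
  qed
  then show ?thesis by blast
qed

text \<open>The derivative is bounded on the compact interval. This gives the velocity the
  regularity under which an inequality at almost every time can be integrated.\<close>

lemma C1_imp_lipschitz_on:
  fixes v :: "real \<Rightarrow> 'a::real_normed_vector"
  assumes "\<And>t. t \<ge> 0 \<Longrightarrow> (v has_vector_derivative v' t) (at t within {0..})"
    and "continuous_on {0..} v'"
  shows "\<exists>L. L-lipschitz_on {0..T} v"
proof -
  have "compact (v' ` {0..T})"
    using assms(2) by (intro compact_continuous_image) (auto intro: continuous_on_subset)
  then obtain B where B: "B > 0" "\<And>t. t \<in> {0..T} \<Longrightarrow> norm (v' t) \<le> B"
    using compact_imp_bounded[of "v' ` {0..T}"] unfolding bounded_pos by auto
  have "B-lipschitz_on {0..T} v"
  proof (rule bounded_derivative_imp_lipschitz)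
    fix t assume t: "t \<in> {0..T}"
    then show "(v has_derivative (\<lambda>h. h *\<^sub>R v' t)) (at t within {0..T})"
      using assms(1)[of t] by (auto simp: has_vector_derivative_def intro: has_derivative_subset)
    show "onorm (\<lambda>h. h *\<^sub>R v' t) \<le> B"
      using B t by (intro onorm_bound) (auto intro: mult_right_mono simp: mult.commute[of "\<bar>_\<bar>"])
  qed (use B in auto)
  then show ?thesis by blast
qed

text \<open>Gronwall's inequality for Lipschitz functions: with the integrating factor
  \<open>exp (c * t)\<close> the product is still Lipschitz and has nonpositive derivative at almost
  every time.\<close>

lemma AE_differential_inequality_imp_exp_decay:
  fixes f :: "real \<Rightarrow> real"
  assumes T: "T \<ge> 0" and lip: "\<exists>L. L-lipschitz_on {0..T} f"
    and deriv: "AE t in lborel. t > 0 \<longrightarrow>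
      (\<exists>D. (f has_real_derivative D) (at t) \<and> D \<le> - c * f t)"
  shows "f T \<le> exp (- c * T) * f 0"
proof -
  have "\<exists>L. L-lipschitz_on {0..T} (\<lambda>t. exp (c * t))"
    by (rule C1_imp_lipschitz_on[where v' = "\<lambda>t. c * exp (c * t)"])
      (auto intro!: derivative_eq_intros continuous_intros
        simp flip: has_real_derivative_iff_has_vector_derivative)
  then obtain L where "L-lipschitz_on {0..T} (\<lambda>t. exp (c * t) * f t)"
    using lipschitz_on_inner[of "{0..T}" "\<lambda>t. exp (c * t)" f] lip by auto
  with T have "exp (c * T) * f T \<le> exp (c * 0) * f 0"
  proof (rule lipschitz_AE_deriv_nonpos_imp_le)
    show "AE t in lborel. t \<in> {0<..<T} \<longrightarrow>
      (\<exists>D. ((\<lambda>t. exp (c * t) * f t) has_real_derivative D) (at t) \<and> D \<le> 0)"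
      using deriv
    proof eventually_elim
      case (elim t)
      show ?case
      proof
        assume "t \<in> {0<..<T}"
        then obtain D where D: "(f has_real_derivative D) (at t)" "D \<le> - c * f t"
          using elim by auto
        have "((\<lambda>t. exp (c * t) * f t) has_real_derivative exp (c * t) * (c * f t + D)) (at t)"
          by (auto intro!: derivative_eq_intros D simp: algebra_simps)
        moreover have "exp (c * t) * (c * f t + D) \<le> 0"
          using D(2) by (simp add: mult_le_0_iff)
        ultimately show "\<exists>D. ((\<lambda>t. exp (c * t) * f t) has_real_derivative D) (at t) \<and> D \<le> 0"
          by blast
      qed
    qed
  qed
  then show ?thesis by (simp add: exp_minus field_simps)
qed

section \<open>Decay of a damped projected flow in an inner product space\<close>

lemma has_real_derivative_inner:
  fixes f g :: "real \<Rightarrow> 'a::real_inner"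
  assumes "(f has_vector_derivative f') (at t)" "(g has_vector_derivative g') (at t)"
  shows "((\<lambda>t. f t \<bullet> g t) has_real_derivative f' \<bullet> g t + f t \<bullet> g') (at t)"
proof -
  have "(\<lambda>h. f t \<bullet> (h *\<^sub>R g') + (h *\<^sub>R f') \<bullet> g t) = (*) (f' \<bullet> g t + f t \<bullet> g')"
  proof
    fix h
    show "f t \<bullet> (h *\<^sub>R g') + (h *\<^sub>R f') \<bullet> g t = (f' \<bullet> g t + f t \<bullet> g') * h"
      by (simp add: distrib_right)
  qed
  then show ?thesis
    using has_derivative_inner[OF assms[unfolded has_vector_derivative_def]]
    by (simp only: has_field_derivative_def)
qed

text \<open>The energy alone dissipates only the velocity. The cross term turns the restoring force
  into decay of \<open>X\<close>, and the damping pays for the error terms that it creates.\<close>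

lemma damped_projected_flow_tendsto_0:
  fixes X v :: "real \<Rightarrow> 'a::real_inner" and P :: "real \<Rightarrow> 'a \<Rightarrow> 'a"
  assumes \<gamma>: "\<gamma> > 0"
    and lipX: "\<And>T. T \<ge> 0 \<Longrightarrow> \<exists>L. L-lipschitz_on {0..T} X"
    and lipv: "\<And>T. T \<ge> 0 \<Longrightarrow> \<exists>L. L-lipschitz_on {0..T} v"
    and adj: "\<And>t x y. t \<ge> 0 \<Longrightarrow> P t x \<bullet> y = x \<bullet> P t y"
    and contr: "\<And>t x. t \<ge> 0 \<Longrightarrow> norm (P t x) \<le> norm x"
    and fixX: "\<And>t. t \<ge> 0 \<Longrightarrow> P t (X t) = X t"
    and pos: "\<And>t. t \<ge> 0 \<Longrightarrow> 0 \<le> X t \<bullet> l"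
    and flow: "AE t in lborel. t > 0 \<longrightarrow> (X has_vector_derivative P t (v t)) (at t) \<and>
      (v has_vector_derivative - P t (X t + l) - \<gamma> *\<^sub>R v t) (at t)"
  shows "((\<lambda>t. norm (X t) + norm (v t)) \<longlongrightarrow> 0) at_top"
proof -
  \<comment> \<open>Chosen so that the damping coefficient \<open>\<gamma>\<close> equals
    \<open>\<epsilon> * (3 + \<gamma>\<^sup>2)\<close> and dominates all errors of order
    \<open>\<epsilon>\<close>. The next inequality yields \<open>\<epsilon> \<le> 1/2\<close>, used
    to compare \<open>G\<close> with \<open>E\<close>.\<close>
  define \<epsilon> where "\<epsilon> = \<gamma> / (3 + \<gamma>\<^sup>2)"
  have "2 * \<gamma> \<le> 3 + \<gamma>\<^sup>2"
    using zero_le_power2[of "\<gamma> - 1"] by (simp add: power2_diff)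
  then have \<epsilon>: "0 < \<epsilon>" "\<epsilon> \<le> 1/2" "\<epsilon> * (3 + \<gamma>\<^sup>2) = \<gamma>"
    using \<gamma> zero_le_power2[of \<gamma>]
    by (auto simp: \<epsilon>_def field_simps add_pos_nonneg)
  \<comment> \<open>In the application \<open>X t \<bullet> l\<close> is the interaction energy,
    half the double integral of |X(eta) - X(s)| for nondecreasing X, so \<open>E\<close> is the
    total energy.\<close>
  define E where "E t = (X t \<bullet> X t) / 2 + X t \<bullet> l + (v t \<bullet> v t) / 2" for t
  define G where "G t = E t + \<epsilon> * (X t \<bullet> v t)" for t
  have Xv: "\<bar>X t \<bullet> v t\<bar> \<le> (X t \<bullet> X t + v t \<bullet> v t) / 2" for t
  proof -
    have "0 \<le> (X t + v t) \<bullet> (X t + v t)" "0 \<le> (X t - v t) \<bullet> (X t - v t)" by simp_all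
    then show ?thesis
      by (simp add: inner_add_left inner_add_right inner_diff_left inner_diff_right inner_commute)
  qed
  \<comment> \<open>The cross term is at most \<open>E t / 2\<close> in absolute value, because
    \<open>\<epsilon> \<le> 1/2\<close> and \<open>X t \<bullet> l \<ge> 0\<close>.\<close>
  have GE: "E t \<le> 2 * G t" "G t \<le> 2 * E t" if "t \<ge> 0" for t
  proof -
    have "\<bar>\<epsilon> * (X t \<bullet> v t)\<bar> \<le> \<epsilon> * ((X t \<bullet> X t + v t \<bullet> v t) / 2)"
      unfolding abs_mult using Xv[of t] \<epsilon> by (intro mult_mono) auto
    also have "\<dots> \<le> 1/2 * ((X t \<bullet> X t + v t \<bullet> v t) / 2)"
      using \<epsilon> by (intro mult_right_mono) auto
    also have "\<dots> \<le> 1/2 * E t" using pos[OF that] by (simp add: E_def)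
    finally show "E t \<le> 2 * G t" "G t \<le> 2 * E t"
      using pos[OF that] inner_ge_zero[of "X t"] inner_ge_zero[of "v t"]
      unfolding G_def by (auto simp: E_def abs_le_iff)
  qed
  have lipG: "\<exists>L. L-lipschitz_on {0..T} G" if "T \<ge> 0" for T
  proof -
    note X = lipX[OF that] and v = lipv[OF that]
    have l: "\<exists>L. L-lipschitz_on {0..T} (\<lambda>_. l)" using lipschitz_on_constant by blast
    obtain a b c d where
      "a-lipschitz_on {0..T} (\<lambda>t. X t \<bullet> X t)" "b-lipschitz_on {0..T} (\<lambda>t. X t \<bullet> l)"
      "c-lipschitz_on {0..T} (\<lambda>t. v t \<bullet> v t)" "d-lipschitz_on {0..T} (\<lambda>t. X t \<bullet> v t)"
      using lipschitz_on_inner[OF compact_Icc X X] lipschitz_on_inner[OF compact_Icc X l]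
        lipschitz_on_inner[OF compact_Icc v v] lipschitz_on_inner[OF compact_Icc X v] by blast
    then have "(1/2 * a + b + 1/2 * c + \<epsilon> * d)-lipschitz_on {0..T}
        (\<lambda>t. 1/2 * (X t \<bullet> X t) + X t \<bullet> l + 1/2 * (v t \<bullet> v t) + \<epsilon> * (X t \<bullet> v t))"
      using \<epsilon> by (intro lipschitz_on_add lipschitz_on_cmult_real_nonneg) auto
    then show ?thesis by (auto simp: G_def[abs_def] E_def)
  qed
  have derivG: "AE t in lborel. t > 0 \<longrightarrow>
      (\<exists>D. (G has_real_derivative D) (at t) \<and> D \<le> - (\<epsilon> / 2) * G t)"
    using flow
  proof eventually_elim
    case (elim t)
    show ?case
    proof
      assume t: "t > 0"
      let ?X' = "P t (v t)" and ?v' = "- P t (X t + l) - \<gamma> *\<^sub>R v t"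
      have X': "(X has_vector_derivative ?X') (at t)" and v': "(v has_vector_derivative ?v') (at t)"
        using elim t by auto
      let ?D = "(?X' \<bullet> X t + X t \<bullet> ?X') / 2 + (?X' \<bullet> l + X t \<bullet> 0) + (?v' \<bullet> v t + v t \<bullet> ?v') / 2
        + \<epsilon> * (?X' \<bullet> v t + X t \<bullet> ?v')"
      have "(G has_real_derivative ?D) (at t)"
        unfolding G_def E_def
        by (intro DERIV_add DERIV_cmult DERIV_cdivide has_real_derivative_inner X' v'
            has_vector_derivative_const)
      moreover have "?D \<le> - (\<epsilon> / 2) * G t"
      proof -
        \<comment> \<open>Self-adjointness moves the projection from the force to the velocity, so
          the work of the projected force cancels the rate of change of the potential
          energy.\<close>
        have 1: "P t (X t + l) \<bullet> v t = ?X' \<bullet> X t + ?X' \<bullet> l"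
          using adj[of t "X t + l" "v t"] t by (simp add: inner_add_left inner_commute)
        \<comment> \<open>As \<open>P t\<close> fixes \<open>X t\<close>, the cross term sees the
          full force, which provides the decay of \<open>X\<close>.\<close>
        have 2: "X t \<bullet> P t (X t + l) = X t \<bullet> X t + X t \<bullet> l"
          using adj[of t "X t" "X t + l"] fixX[of t] t by (simp add: inner_add_right)
        have D: "?D = \<epsilon> * (?X' \<bullet> v t) - \<gamma> * (v t \<bullet> v t) - \<epsilon> * (X t \<bullet> X t + X t \<bullet> l)
            - \<epsilon> * \<gamma> * (X t \<bullet> v t)"
        proof -
          have "?v' \<bullet> v t = - (P t (X t + l) \<bullet> v t) - \<gamma> * (v t \<bullet> v t)"
            "X t \<bullet> ?v' = - (X t \<bullet> P t (X t + l)) - \<gamma> * (X t \<bullet> v t)"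
            by (simp_all add: inner_diff_left inner_diff_right)
          moreover have "v t \<bullet> ?v' = ?v' \<bullet> v t" "X t \<bullet> ?X' = ?X' \<bullet> X t" by (rule inner_commute)+
          ultimately show ?thesis unfolding 1 2 by (simp only:) (simp add: 1 2 field_simps)
        qed
        have "?X' \<bullet> v t \<le> norm ?X' * norm (v t)" by (rule norm_cauchy_schwarz)
        also have "\<dots> \<le> norm (v t) * norm (v t)" using contr[of t "v t"] t by (intro mult_right_mono) auto
        finally have a: "\<epsilon> * (?X' \<bullet> v t) \<le> \<epsilon> * (v t \<bullet> v t)"
          using \<epsilon> by (intro mult_left_mono) (auto simp: dot_square_norm power2_eq_square)
        \<comment> \<open>Young's inequality for the friction part of the cross term: half of
          \<open>X t \<bullet> X t\<close> is given up, the other half is kept for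
          \<open>E t\<close>.\<close>
        have "0 \<le> (X t + \<gamma> *\<^sub>R v t) \<bullet> (X t + \<gamma> *\<^sub>R v t)" by simp
        then have "- (\<gamma> * (X t \<bullet> v t)) \<le> (X t \<bullet> X t) / 2 + \<gamma>\<^sup>2 * (v t \<bullet> v t) / 2"
          by (simp add: inner_add_left inner_add_right inner_commute power2_eq_square)
        then have b: "\<epsilon> * (- (\<gamma> * (X t \<bullet> v t))) \<le> \<epsilon> * ((X t \<bullet> X t) / 2 + \<gamma>\<^sup>2 * (v t \<bullet> v t) / 2)"
          using \<epsilon> by (intro mult_left_mono) auto
        \<comment> \<open>Of the coefficient \<open>3 + \<gamma>\<^sup>2\<close>, the part
          \<open>1 + \<gamma>\<^sup>2 / 2\<close> absorbs the errors and \<open>1/2\<close> supplies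
          the kinetic energy in \<open>E t\<close>; the rest is dropped.\<close>
        have "?D \<le> \<epsilon> * (v t \<bullet> v t) - (\<epsilon> * (3 + \<gamma>\<^sup>2)) * (v t \<bullet> v t) - \<epsilon> * (X t \<bullet> X t + X t \<bullet> l)
            + \<epsilon> * ((X t \<bullet> X t) / 2 + \<gamma>\<^sup>2 * (v t \<bullet> v t) / 2)"
          unfolding D \<epsilon>(3) using a b by (simp add: mult.assoc)
        also have "\<dots> = - \<epsilon> * E t - \<epsilon> * ((3 + \<gamma>\<^sup>2) / 2 * (v t \<bullet> v t))"
          by (simp add: E_def algebra_simps add_divide_distrib)
        also have "\<dots> \<le> - \<epsilon> * E t" using \<epsilon> by simp
        also have "\<dots> \<le> - \<epsilon> * (G t / 2)"
          using GE(2)[of t] t \<epsilon> by (intro mult_left_mono_neg) auto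
        finally show ?thesis by simp
      qed
      ultimately show "\<exists>D. (G has_real_derivative D) (at t) \<and> D \<le> - (\<epsilon> / 2) * G t" by blast
    qed
  qed
  \<comment> \<open>Each squared norm is at most \<open>2 * E t\<close>, hence at most
    \<open>4 * G t\<close>, and \<open>G\<close> decays exponentially.\<close>
  have bound: "norm (X t) + norm (v t) \<le> 2 * sqrt (4 * (exp (- (\<epsilon> / 2) * t) * G 0))" if t: "t \<ge> 0" for t
  proof -
    have "E t \<le> 2 * (exp (- (\<epsilon> / 2) * t) * G 0)"
      using AE_differential_inequality_imp_exp_decay[OF t lipG[OF t] derivG] GE(1)[OF t] by simp
    moreover have "X t \<bullet> X t \<le> 2 * E t" "v t \<bullet> v t \<le> 2 * E t"
      using pos[OF t] by (auto simp: E_def)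
    ultimately have "norm (X t) \<le> sqrt (4 * (exp (- (\<epsilon> / 2) * t) * G 0))"
      "norm (v t) \<le> sqrt (4 * (exp (- (\<epsilon> / 2) * t) * G 0))"
      unfolding norm_eq_sqrt_inner by (auto intro!: real_sqrt_le_mono)
    then show ?thesis by simp
  qed
  have "((\<lambda>t. exp (- (\<epsilon> / 2) * t)) \<longlongrightarrow> 0) at_top"
    using \<epsilon> by real_asymp
  then have "((\<lambda>t. 2 * sqrt (4 * (exp (- (\<epsilon> / 2) * t) * G 0))) \<longlongrightarrow> 2 * sqrt (4 * (0 * G 0))) at_top"
    by (intro tendsto_intros)
  then have lim: "((\<lambda>t. 2 * sqrt (4 * (exp (- (\<epsilon> / 2) * t) * G 0))) \<longlongrightarrow> 0) at_top" by simp
  have le: "eventually (\<lambda>t. norm (X t) + norm (v t) \<le> 2 * sqrt (4 * (exp (- (\<epsilon> / 2) * t) * G 0))) at_top"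
    using bound by (rule eventually_at_top_linorderI[of 0])
  show ?thesis
    by (rule tendsto_sandwich[OF _ le tendsto_const lim]) simp
qed

section \<open>The sticky projection\<close>

lemma open_components_sequence:
  fixes U :: "'a::euclidean_space set"
  assumes "open U"
  obtains A :: "nat \<Rightarrow> 'a set" where "disjoint_family A" "(\<Union>n. A n) = U"
    "\<And>n. A n \<in> components U \<or> A n = {}"
proof -
  have disj: "pairwise disjnt (components U)"
    using components_nonoverlap by (fastforce simp: pairwise_def disjnt_def)
  have c: "countable (components U)"
    using disj open_components[OF assms] by (intro countable_disjoint_open_subsets)
  define A where "A n = (if n \<in> to_nat_on (components U) ` components U
    then from_nat_into (components U) n else {})" for n
  have A: "A (to_nat_on (components U) I) = I" if "I \<in> components U" for I
    using that c by (simp add: A_def)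
  have "disjoint_family A"
    unfolding disjoint_family_on_def
  proof (intro ballI impI)
    fix m n :: nat assume "m \<noteq> n"
    show "A m \<inter> A n = {}"
    proof (rule ccontr)
      assume ne: "A m \<inter> A n \<noteq> {}"
      then have "m \<in> to_nat_on (components U) ` components U" "n \<in> to_nat_on (components U) ` components U"
        by (auto simp: A_def split: if_splits)
      then obtain I J where IJ: "I \<in> components U" "J \<in> components U"
        and mn: "m = to_nat_on (components U) I" "n = to_nat_on (components U) J"
        by (elim imageE)
      with ne have "I = J" using A components_eq[of I U J] by simp
      with mn \<open>m \<noteq> n\<close> show False by simp
    qed
  qed
  moreover have "(\<Union>n. A n) = U"
  proof
    show "(\<Union>n. A n) \<subseteq> U"
      using c by (auto simp: A_def split: if_splits dest: in_components_subset)
    show "U \<subseteq> (\<Union>n. A n)"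
    proof
      fix x assume "x \<in> U"
      then obtain I where "I \<in> components U" "x \<in> I"
        using Union_components[of U] by blast
      then show "x \<in> (\<Union>n. A n)" using A by blast
    qed
  qed
  moreover have "A n \<in> components U \<or> A n = {}" for n
    using c by (auto simp: A_def)
  ultimately show ?thesis using that by blast
qed

text \<open>Countable additivity reduces the comparison to single cells; it is used with cells on
  which the sticky projection is the identity or a constant.\<close>

lemma nn_integral_mono_partition:
  fixes B :: "nat \<Rightarrow> 'a set"
  assumes B: "\<And>n. B n \<in> sets M" "disjoint_family B" "(\<Union>n. B n) = space M"
    and m: "f \<in> borel_measurable M" "g \<in> borel_measurable M"
    and le: "\<And>n. (\<integral>\<^sup>+x\<in>B n. f x \<partial>M) \<le> (\<integral>\<^sup>+x\<in>B n. g x \<partial>M)"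
  shows "(\<integral>\<^sup>+x. f x \<partial>M) \<le> (\<integral>\<^sup>+x. g x \<partial>M)"
proof -
  have *: "(\<integral>\<^sup>+x. h x \<partial>M) = (\<Sum>n. \<integral>\<^sup>+x\<in>B n. h x \<partial>M)" if "h \<in> borel_measurable M" for h
  proof -
    have "(\<integral>\<^sup>+x. h x \<partial>M) = (\<integral>\<^sup>+x\<in>(\<Union>n. B n). h x \<partial>M)"
      unfolding B(3) by (intro nn_integral_cong) auto
    then show ?thesis using nn_integral_disjoint_family[OF that B(1,2)] by simp
  qed
  show ?thesis unfolding *[OF m(1)] *[OF m(2)] by (intro suminf_le le) auto
qed

lemma integral_eq_partition:
  fixes B :: "nat \<Rightarrow> 'a set" and f g :: "'a \<Rightarrow> real"
  assumes B: "\<And>n. B n \<in> sets M" "disjoint_family B" "(\<Union>n. B n) = space M"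
    and i: "integrable M f" "integrable M g"
    and eq: "\<And>n. (LINT x:B n|M. f x) = (LINT x:B n|M. g x)"
  shows "(LINT x|M. f x) = (LINT x|M. g x)"
proof -
  have *: "(LINT x|M. h x) = (\<Sum>n. LINT x:B n|M. h x)" if "integrable M h" for h :: "'a \<Rightarrow> real"
  proof -
    have "(LINT x|M. h x) = (LINT x:(\<Union>n. B n)|M. h x)"
      unfolding B(3) set_lebesgue_integral_def by (intro Bochner_Integration.integral_cong) auto
    also have "\<dots> = (\<Sum>n. LINT x:B n|M. h x)"
    proof (rule lebesgue_integral_countable_add[OF B(1)])
      show "set_integrable M (\<Union>n. B n) h"
        unfolding set_integrable_def using that B(1) by (intro integrable_mult_indicator) auto
    qed (use B(2) in \<open>auto simp: disjoint_family_on_def\<close>)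
    finally show ?thesis .
  qed
  show ?thesis unfolding *[OF i(1)] *[OF i(2)] eq ..
qed

section \<open>Square integrable functions on Omega and the components of
  \<open>const_set\<close>\<close>

lemma prob_space_Leb_Omega: "prob_space Leb_Omega"
  by (rule prob_spaceI) (simp add: emeasure_restrict_space)

lemma square_integrable_const: "square_integrable (\<lambda>_. c)"
proof -
  interpret prob_space Leb_Omega by (rule prob_space_Leb_Omega)
  show ?thesis by (simp add: square_integrable_def)
qed

lemma integrable_L2: "square_integrable f \<Longrightarrow> integrable Leb_Omega f"
  using square_integrable_mult[of f "\<lambda>_. 1"] square_integrable_const by simp

lemma integrable_power2_L2:
  "square_integrable f \<Longrightarrow> integrable Leb_Omega (\<lambda>x. (f x)\<^sup>2)"
  by (simp add: square_integrable_def)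

lemma open_const_set: "open (const_set X)"
  unfolding const_set_def by (subst open_subopen) blast

lemma const_set_subset: "const_set X \<subseteq> {0<..<1}"
  unfolding const_set_def by auto

text \<open>A nonempty open set is not negligible, so the averages in the projection never divide by
  zero.\<close>

lemma component_const_set:
  assumes "I \<in> components (const_set X)"
  shows "open I" "I \<subseteq> {0<..<1}" "I \<in> sets Leb_Omega" "measure Leb_Omega I > 0"
proof -
  show o: "open I" using open_components[OF open_const_set assms] .
  show s: "I \<subseteq> {0<..<1}" using in_components_subset[OF assms] const_set_subset by blast
  then have s': "I \<subseteq> {0..1}" by force
  show "I \<in> sets Leb_Omega"
    using o s' by (simp add: sets_restrict_space_iff lborelD)
  have "\<not> negligible I"
    using o in_components_nonempty[OF assms] open_not_negligible by blast
  then have "emeasure lebesgue I \<noteq> 0"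
    using o by (auto simp: negligible_iff_null_sets null_sets_def lborelD)
  then have "emeasure Leb_Omega I \<noteq> 0"
    using s' by (simp add: emeasure_restrict_space)
  interpret prob_space Leb_Omega by (rule prob_space_Leb_Omega)
  show "measure Leb_Omega I > 0"
    using \<open>emeasure Leb_Omega I \<noteq> 0\<close> by (simp add: emeasure_eq_measure less_le)
qed

text \<open>These cells separate the two regimes of the projection: identity off
  \<open>const_set X\<close>, averaging on each component. Openness makes the components
  countable.\<close>

lemma const_set_partition:
  obtains B :: "nat \<Rightarrow> real set" where "\<And>n. B n \<in> sets Leb_Omega" "disjoint_family B"
    "(\<Union>n. B n) = space Leb_Omega"
    "\<And>n. B n = {} \<or> B n = {0..1} - const_set X \<or> B n \<in> components (const_set X)"
proof -
  obtain A :: "nat \<Rightarrow> real set" where A: "disjoint_family A" "(\<Union>n. A n) = const_set X"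
    "\<And>n. A n \<in> components (const_set X) \<or> A n = {}"
    using open_components_sequence[OF open_const_set[of X]] by metis
  define B where "B n = (case n of 0 \<Rightarrow> {0..1} - const_set X | Suc k \<Rightarrow> A k)" for n
  have sub: "A k \<subseteq> const_set X" for k using A(2) by blast
  have "B n = {} \<or> B n = {0..1} - const_set X \<or> B n \<in> components (const_set X)" for n
    using A(3) by (auto simp: B_def split: nat.split)
  moreover have "disjoint_family B"
    using A(1) sub by (fastforce simp: B_def disjoint_family_on_def split: nat.split)
  moreover have "(\<Union>n. B n) = B 0 \<union> (\<Union>n. B (Suc n))"
    using UN_Un_distrib by (metis UNIV_nat_eq UN_insert image_image)
  then have "(\<Union>n. B n) = space Leb_Omega"
    using A(2) const_set_subset[of X] by (auto simp: B_def)
  moreover have "{0..1} - const_set X \<in> sets Leb_Omega"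
    using open_const_set[of X] by (simp add: sets_restrict_space_iff lborelD sets.Diff)
  with calculation(1) have "B n \<in> sets Leb_Omega" for n
    using component_const_set(3) by (metis sets.empty_sets)
  ultimately show ?thesis using that by blast
qed

section \<open>The sticky projection of functions: averages, contraction and symmetry\<close>

lemma sticky_proj_fun_outside: "x \<notin> const_set X \<Longrightarrow> sticky_proj_fun X f x = f x"
  by (simp add: sticky_proj_fun_def)

lemma sticky_proj_fun_component:
  assumes I: "I \<in> components (const_set X)" and x: "x \<in> I"
  shows "sticky_proj_fun X f x = (LINT s:I|Leb_Omega. f s) / measure Leb_Omega I"
proof -
  have "connected_component_set (const_set X) x = I" "x \<in> const_set X"
    using I x by (metis components_iff connected_component_eq, metis in_components_subset subsetD)
  moreover have sub: "I \<subseteq> {0..1}" using component_const_set(2)[OF I] by force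
  then have "measure lebesgue I = measure Leb_Omega I"
    by (simp add: measure_restrict_space)
  moreover have "(LINT s:I|lebesgue. f s) = (LINT s:I|Leb_Omega. f s)"
    using sub by (subst set_integral_restrict_space)
      (auto simp: set_lebesgue_integral_def indicator_def intro!: Bochner_Integration.integral_cong)
  ultimately show ?thesis by (simp add: sticky_proj_fun_def Let_def)
qed

lemma borel_measurable_sticky_proj_fun:
  assumes "f \<in> borel_measurable Leb_Omega"
  shows "sticky_proj_fun X f \<in> borel_measurable Leb_Omega"
proof -
  obtain B :: "nat \<Rightarrow> real set" where B: "\<And>n. B n \<in> sets Leb_Omega" "(\<Union>n. B n) = space Leb_Omega"
    "\<And>n. B n = {} \<or> B n = {0..1} - const_set X \<or> B n \<in> components (const_set X)"
    using const_set_partition by metis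
  show ?thesis
  proof (rule measurable_piecewise_restrict2[OF B(1) B(2)[symmetric]])
    fix n
    show "\<exists>h\<in>borel_measurable Leb_Omega. \<forall>x\<in>B n. sticky_proj_fun X f x = h x"
      using B(3)[of n]
    proof (elim disjE)
      assume "B n \<in> components (const_set X)"
      then show ?thesis
        by (intro bexI[of _ "\<lambda>_. (LINT s:B n|Leb_Omega. f s) / measure Leb_Omega (B n)"])
          (auto simp: sticky_proj_fun_component)
    qed (use assms in \<open>auto simp: sticky_proj_fun_outside intro!: bexI[of _ f]\<close>)
  qed
qed

text \<open>Cauchy-Schwarz for the mean \<open>a\<close> of \<open>f\<close> over \<open>I\<close>,
  obtained by expanding the nonnegative integral of (f - a)^2 over \<open>I\<close>.\<close>

lemma (in finite_measure) set_integral_power2_le: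
  fixes f :: "'a \<Rightarrow> real"
  assumes I: "I \<in> sets M" "measure M I > 0"
    and f: "integrable M f" "integrable M (\<lambda>x. (f x)\<^sup>2)"
  shows "((LINT x:I|M. f x) / measure M I)\<^sup>2 * measure M I \<le> (LINT x:I|M. (f x)\<^sup>2)"
proof -
  define a where "a = (LINT x:I|M. f x) / measure M I"
  have F: "(LINT x:I|M. f x) = a * measure M I" using I by (simp add: a_def)
  have int: "set_integrable M I f" "set_integrable M I (\<lambda>x. (f x)\<^sup>2)" "set_integrable M I (\<lambda>x. c)" for c :: real
    unfolding set_integrable_def using I f by (intro integrable_mult_indicator; simp)+
  have "0 \<le> (LINT x:I|M. (f x - a)\<^sup>2)"
    unfolding set_lebesgue_integral_def by (intro Bochner_Integration.integral_nonneg) auto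
  also have "\<dots> = (LINT x:I|M. ((f x)\<^sup>2 - (2 * a) * f x) + a\<^sup>2)"
    by (intro arg_cong[where f = "set_lebesgue_integral M I"]) (auto simp: power2_diff)
  also have "\<dots> = (LINT x:I|M. (f x)\<^sup>2) - 2 * a * (LINT x:I|M. f x) + a\<^sup>2 * measure M I"
    using int I by (subst set_integral_add) (auto intro!: set_integral_diff simp: set_integral_const emeasure_eq_measure)
  finally show ?thesis unfolding a_def[symmetric] unfolding F by (simp add: power2_eq_square)
qed

text \<open>Cauchy-Schwarz on each component, equality elsewhere. The nonnegative integral is used
  because square integrability of the projected function is deduced from this very bound.\<close>

lemma nn_integral_sticky_proj_fun_power2_le:
  assumes "square_integrable f"
  shows "(\<integral>\<^sup>+x. ennreal ((sticky_proj_fun X f x)\<^sup>2) \<partial>Leb_Omega) \<le> (\<integral>\<^sup>+x. ennreal ((f x)\<^sup>2) \<partial>Leb_Omega)"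
proof -
  interpret prob_space Leb_Omega by (rule prob_space_Leb_Omega)
  have m[measurable]: "f \<in> borel_measurable Leb_Omega" using assms by (simp add: square_integrable_def)
  note borel_measurable_sticky_proj_fun[OF m, measurable]
  obtain B :: "nat \<Rightarrow> real set" where B: "\<And>n. B n \<in> sets Leb_Omega" "disjoint_family B"
    "(\<Union>n. B n) = space Leb_Omega"
    "\<And>n. B n = {} \<or> B n = {0..1} - const_set X \<or> B n \<in> components (const_set X)"
    using const_set_partition by metis
  show ?thesis
  proof (rule nn_integral_mono_partition[OF B(1-3)])
    fix n
    show "(\<integral>\<^sup>+x\<in>B n. ennreal ((sticky_proj_fun X f x)\<^sup>2) \<partial>Leb_Omega) \<le> (\<integral>\<^sup>+x\<in>B n. ennreal ((f x)\<^sup>2) \<partial>Leb_Omega)"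
      using B(4)[of n]
    proof (elim disjE)
      assume "B n = {0..1} - const_set X"
      then show ?thesis
        by (intro nn_integral_mono) (auto simp: sticky_proj_fun_outside indicator_def)
    next
      assume I: "B n \<in> components (const_set X)"
      let ?a = "(LINT s:B n|Leb_Omega. f s) / measure Leb_Omega (B n)"
      have "(\<integral>\<^sup>+x\<in>B n. ennreal ((sticky_proj_fun X f x)\<^sup>2) \<partial>Leb_Omega)
          = (\<integral>\<^sup>+x\<in>B n. ennreal (?a\<^sup>2) \<partial>Leb_Omega)"
        by (intro nn_integral_cong) (auto simp: sticky_proj_fun_component[OF I] indicator_def)
      also have "\<dots> = ennreal (?a\<^sup>2 * measure Leb_Omega (B n))"
        using B(1) by (simp add: nn_integral_cmult_indicator emeasure_eq_measure ennreal_mult)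
      also have "\<dots> \<le> ennreal (LINT x:B n|Leb_Omega. (f x)\<^sup>2)"
        using integrable_L2[OF assms] integrable_power2_L2[OF assms]
        by (rule ennreal_leI[OF set_integral_power2_le[OF component_const_set(3,4)[OF I]]])
      also have "\<dots> = (\<integral>\<^sup>+x. ennreal (indicator (B n) x *\<^sub>R (f x)\<^sup>2) \<partial>Leb_Omega)"
        unfolding set_lebesgue_integral_def using B(1) integrable_power2_L2[OF assms]
        by (intro nn_integral_eq_integral[symmetric] integrable_mult_indicator) auto
      also have "\<dots> = (\<integral>\<^sup>+x\<in>B n. ennreal ((f x)\<^sup>2) \<partial>Leb_Omega)"
        by (intro nn_integral_cong) (auto simp: indicator_def)
      finally show ?thesis .
    qed simp
  qed simp_all
qed

lemma square_integrable_sticky_proj_fun: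
  assumes "square_integrable f"
  shows "square_integrable (sticky_proj_fun X f)"
proof -
  have f: "f \<in> borel_measurable Leb_Omega" "integrable Leb_Omega (\<lambda>x. (f x)\<^sup>2)"
    using assms by (auto simp: square_integrable_def)
  have "(\<integral>\<^sup>+x. ennreal ((f x)\<^sup>2) \<partial>Leb_Omega) < \<infinity>"
    using f(2) by (simp add: integrable_iff_bounded)
  then have "(\<integral>\<^sup>+x. ennreal ((sticky_proj_fun X f x)\<^sup>2) \<partial>Leb_Omega) < \<infinity>"
    using nn_integral_sticky_proj_fun_power2_le[OF assms, of X] by (rule le_less_trans[rotated])
  then show ?thesis
    using borel_measurable_sticky_proj_fun[OF f(1)]
    by (auto simp: square_integrable_def integrable_iff_bounded)
qed

lemma integral_sticky_proj_fun_power2_le: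
  assumes "square_integrable f"
  shows "(LINT x|Leb_Omega. (sticky_proj_fun X f x)\<^sup>2) \<le> (LINT x|Leb_Omega. (f x)\<^sup>2)"
  using nn_integral_sticky_proj_fun_power2_le[OF assms, of X]
    integrable_power2_L2[OF assms]
    integrable_power2_L2[OF square_integrable_sticky_proj_fun[OF assms]]
  by (simp add: nn_integral_eq_integral)

text \<open>On a component both sides are the product of the two integrals divided by its length;
  off \<open>const_set X\<close> both integrands are \<open>f x * g x\<close>.\<close>

lemma integral_sticky_proj_fun_mult_commute:
  assumes f: "square_integrable f" and g: "square_integrable g"
  shows "(LINT x|Leb_Omega. sticky_proj_fun X f x * g x) = (LINT x|Leb_Omega. f x * sticky_proj_fun X g x)"
proof -
  obtain B :: "nat \<Rightarrow> real set" where B: "\<And>n. B n \<in> sets Leb_Omega" "disjoint_family B"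
    "(\<Union>n. B n) = space Leb_Omega"
    "\<And>n. B n = {} \<or> B n = {0..1} - const_set X \<or> B n \<in> components (const_set X)"
    using const_set_partition by metis
  show ?thesis
  proof (rule integral_eq_partition[OF B(1-3)])
    fix n
    show "(LINT x:B n|Leb_Omega. sticky_proj_fun X f x * g x) = (LINT x:B n|Leb_Omega. f x * sticky_proj_fun X g x)"
      using B(4)[of n]
    proof (elim disjE)
      assume "B n = {0..1} - const_set X"
      then show ?thesis
        by (intro set_lebesgue_integral_cong B(1)) (auto simp: sticky_proj_fun_outside)
    next
      assume I: "B n \<in> components (const_set X)"
      have "(LINT x:B n|Leb_Omega. sticky_proj_fun X f x * g x)
          = (LINT x:B n|Leb_Omega. (LINT s:B n|Leb_Omega. f s) / measure Leb_Omega (B n) * g x)"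
        by (intro set_lebesgue_integral_cong B(1)) (auto simp: sticky_proj_fun_component[OF I])
      also have "\<dots> = (LINT s:B n|Leb_Omega. f s) * (LINT s:B n|Leb_Omega. g s) / measure Leb_Omega (B n)"
        by simp
      also have "\<dots> = (LINT x:B n|Leb_Omega. f x * ((LINT s:B n|Leb_Omega. g s) / measure Leb_Omega (B n)))"
        by simp
      also have "\<dots> = (LINT x:B n|Leb_Omega. f x * sticky_proj_fun X g x)"
        by (intro set_lebesgue_integral_cong B(1)) (auto simp: sticky_proj_fun_component[OF I])
      finally show ?thesis .
    qed (simp add: set_lebesgue_integral_def)
  qed (use assms in \<open>auto intro!: square_integrable_mult square_integrable_sticky_proj_fun\<close>)
qed

section \<open>The sticky projection as an operator on \<open>L2\<close>\<close>

lemma abs_rep_L2: "abs_L2 (rep_L2 \<zeta>) = \<zeta>"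
  by (rule Quotient3_abs_rep[OF Quotient3_L2])

lemma abs_L2_eqI:
  assumes "square_integrable f" "AE x in Leb_Omega. f x = rep_L2 \<zeta> x"
  shows "abs_L2 f = \<zeta>"
proof -
  have "L2_eq f (rep_L2 \<zeta>)" using assms square_integrable_rep by (simp add: L2_eq_def)
  then have "abs_L2 f = abs_L2 (rep_L2 \<zeta>)" by (rule Quotient3_rel_abs[OF Quotient3_L2])
  then show ?thesis by (simp add: abs_rep_L2)
qed

lemma inner_abs_L2:
  assumes "square_integrable f" "square_integrable g"
  shows "abs_L2 f \<bullet> abs_L2 g = (LINT x|Leb_Omega. f x * g x)"
  using assms by (intro inner_L2.abs_eq) (simp_all add: L2_eq_def)

lemma norm_L2_power2: "(norm \<zeta>)\<^sup>2 = (LINT x|Leb_Omega. (rep_L2 \<zeta> x)\<^sup>2)"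
  using inner_abs_L2[OF square_integrable_rep square_integrable_rep, of \<zeta> \<zeta>]
  by (simp add: abs_rep_L2 dot_square_norm power2_eq_square)

lemma sticky_proj_self_adjoint: "sticky_proj X \<zeta> \<bullet> \<xi> = \<zeta> \<bullet> sticky_proj X \<xi>"
proof -
  have "sticky_proj X \<zeta> \<bullet> abs_L2 (rep_L2 \<xi>) = abs_L2 (rep_L2 \<zeta>) \<bullet> sticky_proj X \<xi>"
    unfolding sticky_proj_def
    by (simp only: inner_abs_L2 integral_sticky_proj_fun_mult_commute
        square_integrable_rep square_integrable_sticky_proj_fun)
  then show ?thesis by (simp add: abs_rep_L2)
qed

lemma norm_sticky_proj_le: "norm (sticky_proj X \<zeta>) \<le> norm \<zeta>"
proof -
  have "(norm (sticky_proj X \<zeta>))\<^sup>2 \<le> (norm \<zeta>)\<^sup>2"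
    unfolding norm_L2_power2[of \<zeta>]
    using integral_sticky_proj_fun_power2_le[OF square_integrable_rep, of X \<zeta>]
      inner_abs_L2[OF square_integrable_sticky_proj_fun square_integrable_sticky_proj_fun,
        OF square_integrable_rep square_integrable_rep, of X \<zeta> X \<zeta>]
    by (simp add: sticky_proj_def dot_square_norm power2_eq_square)
  then show ?thesis by (rule power2_le_imp_le) simp
qed

lemma rc_monotone_rep_rc: "X \<in> mono_cone \<Longrightarrow> rc_monotone_rep (rc X) X"
proof -
  assume "X \<in> mono_cone"
  then have "\<exists>f. rc_monotone_rep f X" by (simp add: mono_cone_def)
  then show ?thesis unfolding rc_def by (rule someI_ex)
qed

text \<open>Membership in \<open>const_set X\<close> gives constancy only near each point;
  connectedness of the component makes it global.\<close>

lemma rc_constant_on_component: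
  assumes "I \<in> components (const_set X)"
  shows "rc X constant_on I"
proof (rule locally_constant_imp_constant[OF in_components_connected[OF assms]])
  fix a assume a: "a \<in> I"
  then have "a \<in> const_set X" using in_components_subset[OF assms] by blast
  then obtain V where "open V" "a \<in> V" "rc X constant_on V" by (auto simp: const_set_def)
  then show "\<exists>T. openin (top_of_set I) T \<and> a \<in> T \<and> (\<forall>x\<in>T. rc X x = rc X a)"
    using a by (intro exI[of _ "I \<inter> V"]) (auto simp: openin_open_Int constant_on_def)
qed

text \<open>The representative agrees almost everywhere with \<open>rc X\<close>, which is constant
  on each component, so each average is that constant.\<close>

lemma sticky_proj_mono_cone:
  assumes "X \<in> mono_cone"
  shows "sticky_proj X X = X"
  unfolding sticky_proj_def
proof (rule abs_L2_eqI)
  show "square_integrable (sticky_proj_fun X (rep_L2 X))"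
    by (intro square_integrable_sticky_proj_fun square_integrable_rep)
  have ae: "AE x in Leb_Omega. rep_L2 X x = rc X x"
    using rc_monotone_rep_rc[OF assms] by (simp add: rc_monotone_rep_def)
  have "sticky_proj_fun X (rep_L2 X) x = rc X x" if x: "x \<in> const_set X" for x
  proof -
    obtain I where I: "I \<in> components (const_set X)" "x \<in> I"
      using x Union_components[of "const_set X"] by blast
    note meas = component_const_set[OF I(1)]
    interpret prob_space Leb_Omega by (rule prob_space_Leb_Omega)
    have "(LINT s:I|Leb_Omega. rep_L2 X s) = (LINT s:I|Leb_Omega. rc X x)"
      unfolding set_lebesgue_integral_def
    proof (rule integral_cong_AE)
      have "rep_L2 X \<in> borel_measurable Leb_Omega"
        using square_integrable_rep by (simp add: square_integrable_def)
      then show "(\<lambda>s. indicator I s *\<^sub>R rep_L2 X s) \<in> borel_measurable Leb_Omega"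
        using meas(3) by simp
      show "(\<lambda>s. indicator I s *\<^sub>R rc X x) \<in> borel_measurable Leb_Omega"
        using meas(3) by simp
      show "AE s in Leb_Omega. indicator I s *\<^sub>R rep_L2 X s = indicator I s *\<^sub>R rc X x"
        using ae
      proof eventually_elim
        case (elim s)
        then show ?case
          using rc_constant_on_component[OF I(1)] I(2) by (auto simp: constant_on_def indicator_def)
      qed
    qed
    also have "\<dots> = rc X x * measure Leb_Omega I"
      using meas(3) by (simp add: set_integral_const emeasure_eq_measure)
    finally show ?thesis
      using meas(4) by (simp add: sticky_proj_fun_component[OF I])
  qed
  then have "sticky_proj_fun X (rep_L2 X) x = rep_L2 X x" if "rep_L2 X x = rc X x" for x
    using that by (cases "x \<in> const_set X") (auto simp: sticky_proj_fun_outside)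
  with ae show "AE x in Leb_Omega. sticky_proj_fun X (rep_L2 X) x = rep_L2 X x"
    by (rule eventually_mono)
qed

section \<open>Sign of the interaction term\<close>

lemma square_integrable_affine: "square_integrable (\<lambda>x. 2 * x - 1)"
proof -
  have "continuous_on {0..1} (\<lambda>x::real. (2 * x - 1)\<^sup>2)" by (intro continuous_intros)
  then have "integrable Leb_Omega (\<lambda>x. (2 * x - 1)\<^sup>2)"
    by (intro continuous_imp_integrable_real)
  moreover have "(\<lambda>x::real. 2 * x - 1) \<in> borel_measurable Leb_Omega"
    by (intro continuous_imp_measurable_on_sets_lebesgue continuous_intros) auto
  ultimately show ?thesis by (simp add: square_integrable_def)
qed

lemma integral_affine: "(LINT x|Leb_Omega. 2 * x - 1) = 0"
proof -
  have "((\<lambda>x::real. 2 * x - 1) has_integral ((1\<^sup>2 - 1) - (0\<^sup>2 - 0))) {0..1}"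
    by (rule fundamental_theorem_of_calculus)
      (auto intro!: derivative_eq_intros simp flip: has_real_derivative_iff_has_vector_derivative)
  then have "integral {0..1} (\<lambda>x::real. 2 * x - 1) = 0" by (simp add: integral_unique)
  then show ?thesis
    using lebesgue_integral_eq_integral[OF integrable_L2[OF square_integrable_affine]] by simp
qed

text \<open>\<open>2\<eta> - 1\<close> has mean zero, so \<open>X\<close> may be replaced by \<open>X - X(1/2)\<close>, which has the sign of \<open>2\<eta> - 1\<close>.\<close>

lemma inner_mono_cone_affine_nonneg:
  assumes "X \<in> mono_cone"
  shows "0 \<le> X \<bullet> abs_L2 (\<lambda>\<eta>. 2 * \<eta> - 1)"
proof -
  note r = rc_monotone_rep_rc[OF assms]
  \<comment> \<open>Monotonicity of \<open>rc X\<close> holds on the open interval, so the two end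
    points are discarded as null sets.\<close>
  have "AE x in Leb_Omega. x \<noteq> 0" "AE x in Leb_Omega. x \<noteq> 1"
    using AE_not_in[of "{0}" Leb_Omega] AE_not_in[of "{1}" Leb_Omega]
    by (simp_all add: null_sets_restrict_space)
  then have "AE x in Leb_Omega. 0 \<le> (rep_L2 X x - rc X (1/2)) * (2 * x - 1)"
    using r[unfolded rc_monotone_rep_def, THEN conjunct1] AE_space
  proof eventually_elim
    case (elim x)
    then have x: "x \<in> {0<..<1}" by auto
    have mono: "mono_on {0<..<1} (rc X)" using r by (simp add: rc_monotone_rep_def)
    show ?case
    proof (cases "x \<le> 1/2")
      case True
      then show ?thesis
        using mono_onD[OF mono x, of "1/2"] elim by (intro mult_nonpos_nonpos) auto
    next
      case False
      then show ?thesis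
        using mono_onD[OF mono _ x, of "1/2"] elim by (intro mult_nonneg_nonneg) auto
    qed
  qed
  then have "0 \<le> (LINT x|Leb_Omega. (rep_L2 X x - rc X (1/2)) * (2 * x - 1))"
    by (rule integral_nonneg_AE)
  also have "\<dots> = (LINT x|Leb_Omega. rep_L2 X x * (2 * x - 1) - rc X (1/2) * (2 * x - 1))"
    by (simp add: left_diff_distrib)
  also have "\<dots> = (LINT x|Leb_Omega. rep_L2 X x * (2 * x - 1)) - rc X (1/2) * (LINT x|Leb_Omega. 2 * x - 1)"
    using square_integrable_mult[OF square_integrable_rep square_integrable_affine, of X]
      integrable_L2[OF square_integrable_affine]
    by (subst Bochner_Integration.integral_diff) (auto simp only: integrable_mult_right integral_mult_right_zero)
  also have "\<dots> = X \<bullet> abs_L2 (\<lambda>\<eta>. 2 * \<eta> - 1)"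
    using inner_abs_L2[OF square_integrable_rep square_integrable_affine, of X]
    by (simp add: integral_affine abs_rep_L2)
  finally show ?thesis .
qed

lemma W2_return_le: "W2 (push_forward X) (return borel 0) \<le> norm X"
proof -
  have m[measurable]: "rep_L2 X \<in> borel_measurable Leb_Omega"
    and i: "integrable Leb_Omega (\<lambda>x. (rep_L2 X x)\<^sup>2)"
    using square_integrable_rep[of X] by (auto simp: square_integrable_def)
  interpret prob_space Leb_Omega by (rule prob_space_Leb_Omega)
  \<comment> \<open>The law of eta -> (X(eta), 0) couples the two measures, and its transport cost
    is exactly the squared norm of \<open>X\<close>.\<close>
  let ?\<pi> = "distr Leb_Omega (borel \<Otimes>\<^sub>M borel) (\<lambda>x. (rep_L2 X x, 0::real))"
  have "?\<pi> \<in> couplings (push_forward X) (return borel 0)"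
    by (simp add: couplings_def push_forward_def distr_distr comp_def)
  then have "W2_cost (push_forward X) (return borel 0) \<le> (\<integral>\<^sup>+ (x, y). ennreal ((x - y)\<^sup>2) \<partial>?\<pi>)"
    unfolding W2_cost_def by (rule INF_lower)
  also have "\<dots> = (\<integral>\<^sup>+ x. ennreal ((rep_L2 X x)\<^sup>2) \<partial>Leb_Omega)"
    by (simp add: nn_integral_distr)
  also have "\<dots> = ennreal ((norm X)\<^sup>2)"
    using i by (simp add: nn_integral_eq_integral norm_L2_power2)
  finally have "enn2real (W2_cost (push_forward X) (return borel 0)) \<le> (norm X)\<^sup>2"
    by (auto intro: enn2real_leI)
  then have "W2 (push_forward X) (return borel 0) \<le> sqrt ((norm X)\<^sup>2)"
    unfolding W2_def by (rule real_sqrt_le_mono)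
  then show ?thesis by simp
qed

section \<open>Exponential decay\<close>

theorem theorem7:
  fixes \<gamma> :: real and X v :: "real \<Rightarrow> L2"
  assumes "\<gamma> > 0"
    and "sticky_Lagrangian_solution \<gamma> X v"
  shows "((\<lambda>t. norm (X t) + norm (v t)) \<longlongrightarrow> 0) at_top \<and>
    ((\<lambda>t. W2 (push_forward (X t)) (return borel 0)) \<longlongrightarrow> 0) at_top"
proof -
  note sol = assms(2)[unfolded sticky_Lagrangian_solution_def]
  obtain v' where v': "\<And>t. t \<ge> 0 \<Longrightarrow> (v has_vector_derivative v' t) (at t within {0..})"
    "continuous_on {0..} v'"
    using sol by blast
  have lim: "((\<lambda>t. norm (X t) + norm (v t)) \<longlongrightarrow> 0) at_top"
  proof (rule damped_projected_flow_tendsto_0[OF assms(1), where P = "\<lambda>t. sticky_proj (X t)"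
        and l = "abs_L2 (\<lambda>\<eta>. 2 * \<eta> - 1)"])
    show "\<exists>L. L-lipschitz_on {0..T} v" for T
      using C1_imp_lipschitz_on[OF v'] .
    show "AE t in lborel. t > 0 \<longrightarrow> (X has_vector_derivative sticky_proj (X t) (v t)) (at t) \<and>
      (v has_vector_derivative
        - sticky_proj (X t) (X t + abs_L2 (\<lambda>\<eta>. 2 * \<eta> - 1)) - \<gamma> *\<^sub>R v t) (at t)"
      using sol by (simp add: force_def)
  qed (use sol in \<open>auto intro: sticky_proj_self_adjoint norm_sticky_proj_le
      sticky_proj_mono_cone inner_mono_cone_affine_nonneg\<close>)
  moreover have "((\<lambda>t. W2 (push_forward (X t)) (return borel 0)) \<longlongrightarrow> 0) at_top"
  \<comment> \<open>The distance is squeezed between 0 and the sum of the norms, whose limit is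
    already known.\<close>
  proof (rule tendsto_sandwich[OF _ _ tendsto_const lim])
    show "eventually (\<lambda>t. 0 \<le> W2 (push_forward (X t)) (return borel 0)) at_top"
      by (simp add: W2_def)
    show "eventually (\<lambda>t. W2 (push_forward (X t)) (return borel 0) \<le> norm (X t) + norm (v t)) at_top"
      by (intro always_eventually allI order_trans[OF W2_return_le]) simp
  qed
  ultimately show ?thesis ..
qed

end
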